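(* Let $\mathbf{x}^{(1)},\mathbf{x}^{(2)},\mathbf{x}^{(3)}\in\mathbb{R}^2$, $\mathbf{a}_{01},\mathbf{a}_{02}\in\mathbb{R}^2$, $\boldsymbol{\alpha}_{01},\boldsymbol{\alpha}_{02}\in\mathbb{R}^3$, and let $(\boldsymbol{\alpha}_1,\mathbf{a}_1)$ and $(\boldsymbol{\alpha}_2,\mathbf{a}_2)$ be two classical solutions on $0\le t\le T$ of the problem (S) described in the context, with initial data $(\boldsymbol{\alpha}_{01},\mathbf{a}_{01})$ and $(\boldsymbol{\alpha}_{02},\mathbf{a}_{02})$ respectively. Put $\mathbf{b}_k^{(j)}(t)=\mathbf{x}^{(j)}-\mathbf{a}_k(t)$ and assume that there exists a constant $c>0$ such that $|\mathbf{b}_k^{(j)}(t)|\ge c$ for $0\le t\le T$, $j=1,2,3$ and $k=1,2$. Then, for $0\le t\le T$, $$|\boldsymbol{\alpha}_1(t)-\boldsymbol{\alpha}_2(t)|^2+|\mathbf{a}_1(t)-\mathbf{a}_2(t)|^2\le e^{Kt}\left(|\boldsymbol{\alpha}_{01}-\boldsymbol{\alpha}_{02}|^2+|\mathbf{a}_{01}-\mathbf{a}_{02}|^2\right),$$ where $K>0$ is a constant depending only on $C_1$, $c$, $E_1(0)$ and $M$ (defined in the context). In particular, continuous dependence on the initial data holds: $$\|\boldsymbol{\alpha}_1-\boldsymbol{\alpha}_2\|_{C([0,T])}+\|\mathbf{a}_1-\mathbf{a}_2\|_{C([0,T])}\to0\quad\text{as }(\boldsymbol{\alpha}_{01},\mathbf{a}_{01})\to(\boldsymbol{\alpha}_{02},\mathbf{a}_{02})$$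 (with $c$ and $T$ fixed).
   Context: The surface tension $\sigma:\mathbb{R}\to[0,\infty)$ is continuously differentiable with locally Lipschitz derivative $\sigma_\theta=\sigma'$, and satisfies: (i) there is a constant $C_1>0$ with $\sigma(\theta)\ge C_1$ for all $\theta\in\mathbb{R}$; (ii) $\sigma_\theta(\theta)\theta\ge0$ for all $\theta$; (iii) $\sigma_\theta(\theta)=0$ if and only if $\theta=0$. $|\cdot|$ is the Euclidean norm and $\|\cdot\|_{C([0,T])}$ the corresponding supremum norm on $[0,T]$. Superscripts are cyclic modulo 3: $\alpha^{(0)}=\alpha^{(3)}$, $\alpha^{(4)}=\alpha^{(1)}$, etc. The misorientations are $\Delta\alpha^{(j)}=\alpha^{(j-1)}-\alpha^{(j)}$, and $\Delta\alpha_k^{(j)}$ denotes those of $\boldsymbol{\alpha}_k$. Problem (S): find $\boldsymbol{\alpha}(t)=(\alpha^{(1)}(t),\alpha^{(2)}(t),\alpha^{(3)}(t))\in\mathbb{R}^3$ and $\mathbf{a}(t)\in\mathbb{R}^2$ such that, with $\mathbf{b}^{(j)}(t)=\mathbf{x}^{(j)}-\mathbf{a}(t)$ (nonzero for all times considered), $$\frac{d\alpha^{(j)}}{dt}=-\Big(\sigma_\theta(\Delta\alpha^{(j+1)})|\mathbf{b}^{(j+1)}|-\sigma_\theta(\Delta\alpha^{(j)})|\mathbf{b}^{(j)}|\Big),\ j=1,2,3,\qquad \frac{d\mathbf{a}}{dt}=\sum_{j=1}^3\sigma(\Delta\alpha^{(j)})\frac{\mathbf{b}^{(j)}}{|\mathbf{b}^{(j)}|},$$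 with prescribed initial values $\boldsymbol{\alpha}(0)$, $\mathbf{a}(0)$. A classical solution is a continuously differentiable pair satisfying these equations. Quantities: $E_1(0)=\sum_{j=1}^3\sigma(\Delta\alpha_1^{(j)}(0))|\mathbf{b}_1^{(j)}(0)|$ and $$M=\sup\Big\{|\sigma(\theta)|+|\sigma_\theta(\theta)|+\frac{|\sigma_\theta(\theta_1)-\sigma_\theta(\theta_2)|}{|\theta_1-\theta_2|}:\ |\theta|,|\theta_1|,|\theta_2|\le\max_{k=1,2}\Big(\sum_{j=1}^3|\Delta\alpha_k^{(j)}(0)|^2\Big)^{1/2}\Big\},$$ the quotient being read as $0$ when $\theta_1=\theta_2$. *)

theory Defs
  imports "HOL-Analysis.Analysis"
begin

text \<open>
  The numeral type \<^typ>\<open>3\<close> carries arithmetic modulo 3, so \<open>j - 1\<close> and \<open>j + 1\<close> below are the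
  cyclic shifts of superscripts.
\<close>

definition misorientation :: "real ^ 3 \<Rightarrow> 3 \<Rightarrow> real" where
  "misorientation \<alpha> j = \<alpha> $ (j - 1) - \<alpha> $ j"

definition surface_tension :: "(real \<Rightarrow> real) \<Rightarrow> real \<Rightarrow> bool" where
  "surface_tension \<sigma> C\<^sub>1 \<longleftrightarrow>
     (\<forall>\<theta>. 0 \<le> \<sigma> \<theta>) \<and>
     (\<forall>\<theta>. \<sigma> field_differentiable (at \<theta>)) \<and>
     continuous_on UNIV (deriv \<sigma>) \<and>
     (\<forall>\<theta>. \<exists>r>0. \<exists>L. L-lipschitz_on (ball \<theta> r) (deriv \<sigma>)) \<and>
     0 < C\<^sub>1 \<and> (\<forall>\<theta>. C\<^sub>1 \<le> \<sigma> \<theta>) \<and>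
     (\<forall>\<theta>. 0 \<le> deriv \<sigma> \<theta> * \<theta>) \<and>
     (\<forall>\<theta>. deriv \<sigma> \<theta> = 0 \<longleftrightarrow> \<theta> = 0)"

text \<open>
  Derivatives are taken within \<open>{0..T}\<close>, hence one-sided at the two endpoints.
\<close>

definition classical_solution ::
  "(real \<Rightarrow> real) \<Rightarrow> (3 \<Rightarrow> real ^ 2) \<Rightarrow> real \<Rightarrow> real ^ 3 \<Rightarrow> real ^ 2 \<Rightarrow>
   (real \<Rightarrow> real ^ 3) \<Rightarrow> (real \<Rightarrow> real ^ 2) \<Rightarrow> bool" where
  "classical_solution \<sigma> x T \<alpha>\<^sub>0 a\<^sub>0 \<alpha> a \<longleftrightarrow>
     \<alpha> 0 = \<alpha>\<^sub>0 \<and> a 0 = a\<^sub>0 \<and>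
     (\<forall>t\<in>{0..T}. \<forall>j. x j - a t \<noteq> 0) \<and>
     (\<exists>\<alpha>' a'. continuous_on {0..T} \<alpha>' \<and> continuous_on {0..T} a' \<and>
       (\<forall>t\<in>{0..T}.
          (\<alpha> has_vector_derivative \<alpha>' t) (at t within {0..T}) \<and>
          (a has_vector_derivative a' t) (at t within {0..T}) \<and>
          (\<forall>j. \<alpha>' t $ j =
             - (deriv \<sigma> (misorientation (\<alpha> t) (j + 1)) * norm (x (j + 1) - a t)
                - deriv \<sigma> (misorientation (\<alpha> t) j) * norm (x j - a t))) \<and>
          a' t = (\<Sum>j\<in>UNIV. \<sigma> (misorientation (\<alpha> t) j) *\<^sub>R
                     ((x j - a t) /\<^sub>R norm (x j - a t)))))"

definition separated_by :: "real \<Rightarrow> (3 \<Rightarrow> real ^ 2) \<Rightarrow> real \<Rightarrow> (real \<Rightarrow> real ^ 2) \<Rightarrow> bool" where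
  "separated_by c x T a \<longleftrightarrow> (\<forall>t\<in>{0..T}. \<forall>j. c \<le> norm (x j - a t))"

definition energy :: "(real \<Rightarrow> real) \<Rightarrow> (3 \<Rightarrow> real ^ 2) \<Rightarrow> real ^ 3 \<Rightarrow> real ^ 2 \<Rightarrow> real" where
  "energy \<sigma> x \<alpha> a = (\<Sum>j\<in>UNIV. \<sigma> (misorientation \<alpha> j) * norm (x j - a))"

definition misorientation_size :: "real ^ 3 \<Rightarrow> real" where
  "misorientation_size \<alpha> = sqrt (\<Sum>j\<in>UNIV. \<bar>misorientation \<alpha> j\<bar>\<^sup>2)"

text \<open>
  The difference quotient is \<open>0\<close> for \<open>\<theta>\<^sub>1 = \<theta>\<^sub>2\<close> since \<open>x / 0 = 0\<close>. The supremum is over a nonempty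
  set, bounded above when \<open>deriv \<sigma>\<close> is locally Lipschitz.
\<close>

definition sigma_bound :: "(real \<Rightarrow> real) \<Rightarrow> real ^ 3 \<Rightarrow> real ^ 3 \<Rightarrow> real" where
  "sigma_bound \<sigma> \<alpha>\<^sub>0\<^sub>1 \<alpha>\<^sub>0\<^sub>2 =
     (let R = max (misorientation_size \<alpha>\<^sub>0\<^sub>1) (misorientation_size \<alpha>\<^sub>0\<^sub>2) in
      Sup {\<bar>\<sigma> \<theta>\<bar> + \<bar>deriv \<sigma> \<theta>\<bar> + \<bar>deriv \<sigma> \<theta>\<^sub>1 - deriv \<sigma> \<theta>\<^sub>2\<bar> / \<bar>\<theta>\<^sub>1 - \<theta>\<^sub>2\<bar> | \<theta> \<theta>\<^sub>1 \<theta>\<^sub>2.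
             \<bar>\<theta>\<bar> \<le> R \<and> \<bar>\<theta>\<^sub>1\<bar> \<le> R \<and> \<bar>\<theta>\<^sub>2\<bar> \<le> R})"

definition sup_norm :: "real \<Rightarrow> (real \<Rightarrow> 'a::real_normed_vector) \<Rightarrow> real" where
  "sup_norm T f = (SUP t\<in>{0..T}. norm (f t))"

end

theory Submission
  imports Defs
begin

text \<open>
  Both the sum of the squared misorientations and the energy decrease along a solution. The first keeps the misorientations in
  the ball over which \<open>M\<close> is the supremum, the second gives \<open>\<bar>x\<^sub>j - a\<^sub>1\<bar> \<le> E\<^sub>1(0) / C\<^sub>1\<close>. On this region,
  and with \<open>\<bar>x\<^sub>j - a\<bar> \<ge> c\<close>, the right-hand side of the system is Lipschitz, so the squared distance \<open>g\<close>
  of two solutions satisfies \<open>g' \<le> K g\<close> and \<open>exp (- K t) g\<close> decreases.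

  The branches of only one solution need an upper bound. For continuous dependence this is taken to
  be the unperturbed solution, so that only \<open>M\<close> has to be controlled uniformly in the initial data.
\<close>

section \<open>The vector field of the system\<close>

definition torque :: "(real \<Rightarrow> real) \<Rightarrow> (3 \<Rightarrow> real ^ 2) \<Rightarrow> real ^ 3 \<Rightarrow> real ^ 2 \<Rightarrow> 3 \<Rightarrow> real" where
  "torque \<sigma> x \<alpha> a j = deriv \<sigma> (misorientation \<alpha> j) * norm (x j - a)"

definition rotation_rate :: "(real \<Rightarrow> real) \<Rightarrow> (3 \<Rightarrow> real ^ 2) \<Rightarrow> real ^ 3 \<Rightarrow> real ^ 2 \<Rightarrow> real ^ 3" where
  "rotation_rate \<sigma> x \<alpha> a = (\<chi> j. torque \<sigma> x \<alpha> a j - torque \<sigma> x \<alpha> a (j + 1))"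

text \<open>With \<open>sgn\<close> for the unit vector, the direction is literally the gradient of
  the norm, which matches \<open>has_real_derivative_norm\<close> in the energy computation.\<close>

definition junction_velocity :: "(real \<Rightarrow> real) \<Rightarrow> (3 \<Rightarrow> real ^ 2) \<Rightarrow> real ^ 3 \<Rightarrow> real ^ 2 \<Rightarrow> real ^ 2" where
  "junction_velocity \<sigma> x \<alpha> a = (\<Sum>j\<in>UNIV. \<sigma> (misorientation \<alpha> j) *\<^sub>R sgn (x j - a))"

lemma classical_solutionD:
  assumes "classical_solution \<sigma> x T \<alpha>\<^sub>0 a\<^sub>0 \<alpha> a"
  shows "\<alpha> 0 = \<alpha>\<^sub>0" "a 0 = a\<^sub>0"
    and "\<And>t j. t \<in> {0..T} \<Longrightarrow> x j - a t \<noteq> 0"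
    and "\<And>t. t \<in> {0..T} \<Longrightarrow>
      (\<alpha> has_vector_derivative rotation_rate \<sigma> x (\<alpha> t) (a t)) (at t within {0..T})"
    and "\<And>t. t \<in> {0..T} \<Longrightarrow>
      (a has_vector_derivative junction_velocity \<sigma> x (\<alpha> t) (a t)) (at t within {0..T})"
proof -
  obtain \<alpha>' a' where *: "\<And>t. t \<in> {0..T} \<Longrightarrow>
          (\<alpha> has_vector_derivative \<alpha>' t) (at t within {0..T}) \<and>
          (a has_vector_derivative a' t) (at t within {0..T}) \<and>
          (\<forall>j. \<alpha>' t $ j =
             - (deriv \<sigma> (misorientation (\<alpha> t) (j + 1)) * norm (x (j + 1) - a t)
                - deriv \<sigma> (misorientation (\<alpha> t) j) * norm (x j - a t))) \<and>
          a' t = (\<Sum>j\<in>UNIV. \<sigma> (misorientation (\<alpha> t) j) *\<^sub>R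
                     ((x j - a t) /\<^sub>R norm (x j - a t)))"
    using assms unfolding classical_solution_def by blast
  show "\<alpha> 0 = \<alpha>\<^sub>0" "a 0 = a\<^sub>0" and "\<And>t j. t \<in> {0..T} \<Longrightarrow> x j - a t \<noteq> 0"
    using assms unfolding classical_solution_def by blast+
  have "\<alpha>' t = rotation_rate \<sigma> x (\<alpha> t) (a t)" "a' t = junction_velocity \<sigma> x (\<alpha> t) (a t)"
    if "t \<in> {0..T}" for t
    using *[OF that]
    by (simp_all add: vec_eq_iff rotation_rate_def torque_def junction_velocity_def sgn_div_norm)
  with * show "\<And>t. t \<in> {0..T} \<Longrightarrow>
      (\<alpha> has_vector_derivative rotation_rate \<sigma> x (\<alpha> t) (a t)) (at t within {0..T})"
    "\<And>t. t \<in> {0..T} \<Longrightarrow>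
      (a has_vector_derivative junction_velocity \<sigma> x (\<alpha> t) (a t)) (at t within {0..T})"
    by metis+
qed

section \<open>Calculus with derivatives taken within a closed interval\<close>

text \<open>The mean value argument uses two-sided derivatives only at interior points, where the
  derivative within the interval is one. At the endpoints continuity is enough.\<close>

lemma antimono_within_interval:
  fixes g g' :: "real \<Rightarrow> real"
  assumes "\<And>s. s \<in> {0..T} \<Longrightarrow> (g has_real_derivative g' s) (at s within {0..T})"
    and "\<And>s. s \<in> {0..T} \<Longrightarrow> g' s \<le> 0"
    and "t \<in> {0..T}"
  shows "g t \<le> g 0"
proof (rule DERIV_nonpos_imp_decreasing_open[of 0 t g])
  show "0 \<le> t" using assms(3) by simp
  show "\<exists>y. (g has_real_derivative y) (at s) \<and> y \<le> 0" if "0 < s" "s < t" for s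
    using assms(1)[of s] assms(2)[of s] assms(3) that
    by (intro exI[of _ "g' s"]) (simp add: at_within_Icc_at)
  have "continuous_on {0..T} g"
    using assms(1) by (meson DERIV_continuous continuous_on_eq_continuous_within)
  then show "continuous_on {0..t} g"
    using assms(3) by (auto intro: continuous_on_subset)
qed

lemma has_real_derivative_vec_nth:
  assumes "(f has_vector_derivative f') F"
  shows "((\<lambda>t. f t $ j) has_real_derivative f' $ j) F"
  using bounded_linear.has_vector_derivative[OF bounded_linear_vec_nth assms]
  by (simp add: has_real_derivative_iff_has_vector_derivative)

lemma has_real_derivative_norm_power2:
  fixes f :: "real \<Rightarrow> 'a::real_inner"
  assumes "(f has_vector_derivative f') (at t within S)"
  shows "((\<lambda>t. (norm (f t))\<^sup>2) has_real_derivative 2 * (f t \<bullet> f')) (at t within S)"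
  using assms unfolding power2_norm_eq_inner has_vector_derivative_def has_field_derivative_def
  by (auto intro!: derivative_eq_intros simp: inner_commute)

lemma has_real_derivative_norm:
  fixes f :: "real \<Rightarrow> 'a::real_inner"
  assumes "(f has_vector_derivative f') (at t within S)" "f t \<noteq> 0"
  shows "((\<lambda>t. norm (f t)) has_real_derivative sgn (f t) \<bullet> f') (at t within S)"
proof -
  have "((\<lambda>t. norm (f t)) has_derivative (\<lambda>h. (h *\<^sub>R f') \<bullet> sgn (f t))) (at t within S)"
    using has_derivative_in_compose[OF assms(1)[unfolded has_vector_derivative_def]
        has_derivative_at_withinI[OF has_derivative_norm[OF assms(2)]]] by simp
  then show ?thesis
    by (simp add: has_field_derivative_def inner_commute mult_commute_abs)
qed

section \<open>Algebra of misorientations on the three-cycle\<close>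

lemma misorientation_diff:
  "misorientation (\<alpha> - \<beta>) j = misorientation \<alpha> j - misorientation \<beta> j"
  by (simp add: misorientation_def)

lemma misorientation_le_norm: "\<bar>misorientation \<alpha> j\<bar> \<le> 2 * norm \<alpha>"
  using component_le_norm_cart[of \<alpha> j] component_le_norm_cart[of \<alpha> "j - 1"]
  by (simp add: misorientation_def)

lemma misorientation_le_size: "\<bar>misorientation \<alpha> j\<bar> \<le> misorientation_size \<alpha>"
proof -
  have "\<bar>misorientation \<alpha> j\<bar>\<^sup>2 \<le> (\<Sum>j\<in>UNIV. \<bar>misorientation \<alpha> j\<bar>\<^sup>2)"
    by (rule member_le_sum) auto
  then show ?thesis unfolding misorientation_size_def by (rule real_le_rsqrt)
qed

text \<open>\<open>sum_3\<close> and \<open>exhaust_3\<close> use the indices 1, 2, 3. These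
  equations bring cyclic shifts back to those representatives, so that equal terms can
  cancel.\<close>

lemma cyclic_3:
  "(0::3) = 3" "(1::3) - 1 = 3" "(2::3) - 1 = 1" "(3::3) - 1 = 2"
  "(1::3) + 1 = 2" "(2::3) + 1 = 3" "(3::3) + 1 = 1"
  by simp_all

text \<open>The left side is the discrete Laplacian of the torques,
  \<open>f (j - 1) - 2 * f j + f (j + 1)\<close>. Since \<open>j - 1\<close>, \<open>j\<close> and
  \<open>j + 1\<close> exhaust the cycle, it equals the full sum minus three times the middle
  term.\<close>

lemma misorientation_rotation_rate:
  "misorientation (rotation_rate \<sigma> x \<alpha> a) j =
     (\<Sum>i\<in>UNIV. torque \<sigma> x \<alpha> a i) - 3 * torque \<sigma> x \<alpha> a j"
  using exhaust_3[of j]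
  by (elim disjE; simp only: misorientation_def rotation_rate_def sum_3 cyclic_3 vec_lambda_beta; simp)

lemma sum_misorientation: "(\<Sum>j\<in>UNIV. misorientation \<alpha> j) = 0"
  by (simp add: misorientation_def sum_3 cyclic_3)

lemma has_real_derivative_misorientation:
  assumes "(\<alpha> has_vector_derivative \<alpha>') F"
  shows "((\<lambda>t. misorientation (\<alpha> t) j) has_real_derivative misorientation \<alpha>' j) F"
  unfolding misorientation_def by (intro derivative_intros has_real_derivative_vec_nth assms)

section \<open>Monotone quantities and a priori bounds\<close>

text \<open>In the derivative of the sum of squares the total torque is multiplied by the sum of the
  misorientations, which is zero. What remains is -6 times the sum of misorientation times torque,
  and each such product is nonnegative by the sign condition on
  \<open>deriv \<sigma>\<close>.\<close>

lemma misorientation_size_antimono: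
  assumes "surface_tension \<sigma> C" "classical_solution \<sigma> x T \<alpha>\<^sub>0 a\<^sub>0 \<alpha> a" "t \<in> {0..T}"
  shows "misorientation_size (\<alpha> t) \<le> misorientation_size \<alpha>\<^sub>0"
proof -
  note sol = classical_solutionD[OF assms(2)]
  let ?\<Delta> = "\<lambda>t. misorientation (\<alpha> t)" and ?f = "\<lambda>t. torque \<sigma> x (\<alpha> t) (a t)"
  let ?D = "\<lambda>t. \<Sum>j\<in>UNIV. 2 * ?\<Delta> t j * misorientation (rotation_rate \<sigma> x (\<alpha> t) (a t)) j"
  have "(\<Sum>j\<in>UNIV. \<bar>?\<Delta> t j\<bar>\<^sup>2) \<le> (\<Sum>j\<in>UNIV. \<bar>?\<Delta> 0 j\<bar>\<^sup>2)"
  proof (rule antimono_within_interval[OF _ _ assms(3), where g' = ?D])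
    fix s assume s: "s \<in> {0..T}"
    show "((\<lambda>t. \<Sum>j\<in>UNIV. \<bar>?\<Delta> t j\<bar>\<^sup>2) has_real_derivative ?D s) (at s within {0..T})"
      unfolding power2_abs
      by (auto intro!: derivative_eq_intros has_real_derivative_misorientation sol(4) s
          simp: mult_ac)
    have "0 \<le> deriv \<sigma> \<theta> * \<theta>" for \<theta>
      using assms(1) by (simp add: surface_tension_def)
    then have "0 \<le> ?\<Delta> s j * ?f s j" for j
      unfolding torque_def by (metis mult.assoc mult.commute mult_nonneg_nonneg norm_ge_zero)
    then have pos: "0 \<le> (\<Sum>j\<in>UNIV. ?\<Delta> s j * ?f s j)"
      by (intro sum_nonneg)
    have "?D s = 2 * (\<Sum>j\<in>UNIV. ?\<Delta> s j) * (\<Sum>j\<in>UNIV. ?f s j) - 6 * (\<Sum>j\<in>UNIV. ?\<Delta> s j * ?f s j)"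
      unfolding misorientation_rotation_rate
      by (simp add: sum_3 algebra_simps)
    with pos show "?D s \<le> 0" by (simp add: sum_misorientation)
  qed
  then show ?thesis
    using sol(1) by (simp add: misorientation_size_def)
qed

text \<open>The system is the gradient flow of the energy in both variables, so the energy decays at
  the rate of the squared norms of \<open>rotation_rate\<close> and
  \<open>junction_velocity\<close>.\<close>

lemma energy_antimono:
  assumes "surface_tension \<sigma> C" "classical_solution \<sigma> x T \<alpha>\<^sub>0 a\<^sub>0 \<alpha> a" "t \<in> {0..T}"
  shows "energy \<sigma> x (\<alpha> t) (a t) \<le> energy \<sigma> x \<alpha>\<^sub>0 a\<^sub>0"
proof -
  note sol = classical_solutionD[OF assms(2)]
  let ?\<Delta> = "\<lambda>t. misorientation (\<alpha> t)" and ?f = "\<lambda>t. torque \<sigma> x (\<alpha> t) (a t)"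
  let ?v = "\<lambda>t. junction_velocity \<sigma> x (\<alpha> t) (a t)"
  let ?D = "\<lambda>t. \<Sum>j\<in>UNIV. deriv \<sigma> (?\<Delta> t j) * misorientation (rotation_rate \<sigma> x (\<alpha> t) (a t)) j * norm (x j - a t)
      + (sgn (x j - a t) \<bullet> (- ?v t)) * \<sigma> (?\<Delta> t j)"
  have "energy \<sigma> x (\<alpha> t) (a t) \<le> energy \<sigma> x (\<alpha> 0) (a 0)"
  proof (rule antimono_within_interval[OF _ _ assms(3), where g' = ?D])
    fix s assume s: "s \<in> {0..T}"
    have \<sigma>: "(\<sigma> has_real_derivative deriv \<sigma> \<theta>) (at \<theta>)" for \<theta>
      using assms(1) by (simp add: surface_tension_def DERIV_deriv_iff_field_differentiable)
    have b: "((\<lambda>t. x j - a t) has_vector_derivative - ?v s) (at s within {0..T})" for j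
      using sol(5)[OF s] by (auto intro!: derivative_eq_intros)
    show "((\<lambda>t. energy \<sigma> x (\<alpha> t) (a t)) has_real_derivative ?D s) (at s within {0..T})"
      unfolding energy_def
      by (intro DERIV_sum DERIV_mult DERIV_chain2[OF \<sigma>] has_real_derivative_misorientation sol(4) s
          has_real_derivative_norm b sol(3))
    have "(\<Sum>j\<in>UNIV. (sgn (x j - a s) \<bullet> (- ?v s)) * \<sigma> (?\<Delta> s j)) = - (norm (?v s))\<^sup>2"
    proof -
      \<comment> \<open>An arbitrary \<open>v\<close> keeps one factor of the inner product folded
        while the definition of the velocity is expanded in the other.\<close>
      have "(\<Sum>j\<in>UNIV. (sgn (x j - a s) \<bullet> (- v)) * \<sigma> (?\<Delta> s j)) = - (?v s \<bullet> v)" for v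
        by (simp add: junction_velocity_def inner_sum_left sum_negf mult.commute)
      then show ?thesis by (simp add: power2_norm_eq_inner)
    qed
    then have "?D s = (\<Sum>j\<in>UNIV. ?f s j * ((\<Sum>j\<in>UNIV. ?f s j) - 3 * ?f s j)) - (norm (?v s))\<^sup>2"
      unfolding misorientation_rotation_rate sum.distrib by (simp add: torque_def mult_ac)
    \<comment> \<open>The square of a sum of three numbers minus three times their sum of squares is
      minus the sum of the squared pairwise differences.\<close>
    also have "\<dots> = - ((?f s 1 - ?f s 2)\<^sup>2 + (?f s 2 - ?f s 3)\<^sup>2 + (?f s 3 - ?f s 1)\<^sup>2) - (norm (?v s))\<^sup>2"
      by (simp add: sum_3 algebra_simps power2_eq_square)
    also have "\<dots> \<le> 0"
      by (smt (verit) zero_le_power2)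
    finally show "?D s \<le> 0" .
  qed
  then show ?thesis by (simp add: sol)
qed

text \<open>All summands of the energy are nonnegative and \<open>\<sigma>\<close> is at least
  \<open>C\<close>, so a single summand already bounds its branch.\<close>

lemma norm_branch_le:
  assumes "surface_tension \<sigma> C" "classical_solution \<sigma> x T \<alpha>\<^sub>0 a\<^sub>0 \<alpha> a" "t \<in> {0..T}"
  shows "norm (x j - a t) \<le> energy \<sigma> x \<alpha>\<^sub>0 a\<^sub>0 / C"
proof -
  have C: "0 < C" "\<And>\<theta>. C \<le> \<sigma> \<theta>" using assms(1) by (auto simp: surface_tension_def)
  then have \<sigma>: "0 \<le> \<sigma> \<theta>" for \<theta> by (meson less_imp_le order_trans)
  have "C * norm (x j - a t) \<le> \<sigma> (misorientation (\<alpha> t) j) * norm (x j - a t)"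
    by (intro mult_right_mono C) auto
  also have "\<dots> \<le> energy \<sigma> x (\<alpha> t) (a t)"
    unfolding energy_def by (rule member_le_sum) (auto simp: \<sigma>)
  also have "\<dots> \<le> energy \<sigma> x \<alpha>\<^sub>0 a\<^sub>0"
    by (rule energy_antimono[OF assms])
  finally show ?thesis using C by (simp add: field_simps)
qed

section \<open>Lipschitz estimates for the vector field\<close>

text \<open>Scaling the difference by \<open>norm u\<close> leaves \<open>u - v\<close> and a
  multiple of the unit vector \<open>sgn v\<close> by the difference of the norms. Both are at most
  \<open>norm (u - v)\<close>, whence the factor 2.\<close>

lemma norm_sgn_diff_le:
  fixes u v :: "'a::real_normed_vector"
  assumes "0 < c" "c \<le> norm u" "c \<le> norm v"
  shows "norm (sgn u - sgn v) \<le> 2 * norm (u - v) / c"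
proof -
  have u: "0 < norm u" and v: "0 < norm v" using assms by linarith+
  have "norm u *\<^sub>R (sgn u - sgn v) = (u - v) - (norm u - norm v) *\<^sub>R sgn v"
    using u v by (simp add: sgn_div_norm algebra_simps)
  also have "norm \<dots> \<le> norm (u - v) + \<bar>norm u - norm v\<bar> * norm (sgn v)"
    by (metis norm_triangle_ineq4 norm_scaleR)
  also have "\<dots> \<le> 2 * norm (u - v)"
    using norm_triangle_ineq3[of u v] v by (simp add: norm_sgn)
  finally have "norm u * norm (sgn u - sgn v) \<le> 2 * norm (u - v)" by simp
  moreover have "c * norm (sgn u - sgn v) \<le> norm u * norm (sgn u - sgn v)"
    using assms by (intro mult_right_mono) auto
  ultimately show ?thesis using assms(1) by (simp add: field_simps)
qed

text \<open>Keeping the radius and the constant abstract lets the estimates be used both with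
  \<open>sigma_bound\<close> and with one constant that serves all initial data near a given
  one.\<close>

definition bounded_on_ball :: "(real \<Rightarrow> real) \<Rightarrow> real \<Rightarrow> real \<Rightarrow> bool" where
  "bounded_on_ball \<sigma> R M \<longleftrightarrow>
     (\<forall>\<theta>\<in>{-R..R}. \<bar>\<sigma> \<theta>\<bar> \<le> M \<and> \<bar>deriv \<sigma> \<theta>\<bar> \<le> M) \<and> M-lipschitz_on {-R..R} \<sigma> \<and> M-lipschitz_on {-R..R} (deriv \<sigma>)"

lemma norm_mult_diff_le:
  fixes p q r s :: "'a::real_normed_algebra"
  shows "norm (p * r - q * s) \<le> norm (p - q) * norm r + norm q * norm (r - s)"
proof -
  have "p * r - q * s = (p - q) * r + q * (r - s)" by (simp add: algebra_simps)
  then show ?thesis by (metis norm_triangle_le add_mono norm_mult_ineq)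
qed

text \<open>The product difference is split so that the change of \<open>deriv \<sigma>\<close> is
  weighted by the branch at \<open>a\<close> only. Hence the bound \<open>B\<close> is asked of that
  branch and not of the one at \<open>b\<close>.\<close>

lemma torque_diff_le:
  assumes M: "bounded_on_ball \<sigma> R M"
    and R: "misorientation_size \<alpha> \<le> R" "misorientation_size \<beta> \<le> R"
    and B: "norm (x j - a) \<le> B"
  shows "\<bar>torque \<sigma> x \<alpha> a j - torque \<sigma> x \<beta> b j\<bar> \<le> 2 * M * B * norm (\<alpha> - \<beta>) + M * norm (a - b)"
proof -
  let ?p = "misorientation \<alpha> j" and ?q = "misorientation \<beta> j"
  have pq: "?p \<in> {-R..R}" "?q \<in> {-R..R}"
    using misorientation_le_size[of \<alpha> j] misorientation_le_size[of \<beta> j] R by auto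
  have M0: "0 \<le> M" using M by (auto simp: bounded_on_ball_def lipschitz_on_def)
  have "\<bar>deriv \<sigma> ?p - deriv \<sigma> ?q\<bar> \<le> M * \<bar>?p - ?q\<bar>"
    using M pq by (auto simp: bounded_on_ball_def lipschitz_on_def dist_real_def)
  also have "\<dots> \<le> M * (2 * norm (\<alpha> - \<beta>))"
    using misorientation_le_norm[of "\<alpha> - \<beta>" j] M0 by (intro mult_left_mono) (simp_all add: misorientation_diff)
  finally have 1: "\<bar>deriv \<sigma> ?p - deriv \<sigma> ?q\<bar> * norm (x j - a) \<le> (M * (2 * norm (\<alpha> - \<beta>))) * B"
    using B M0 by (intro mult_mono) auto
  have "\<bar>norm (x j - a) - norm (x j - b)\<bar> \<le> norm (a - b)"
    using norm_triangle_ineq3[of "x j - a" "x j - b"] by (simp add: norm_minus_commute)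
  then have 2: "\<bar>deriv \<sigma> ?q\<bar> * \<bar>norm (x j - a) - norm (x j - b)\<bar> \<le> M * norm (a - b)"
    using M pq M0 by (intro mult_mono) (auto simp: bounded_on_ball_def)
  show ?thesis
    using norm_mult_diff_le[of "deriv \<sigma> ?p" "norm (x j - a)" "deriv \<sigma> ?q" "norm (x j - b)"] 1 2
    by (simp add: torque_def algebra_simps)
qed

text \<open>Three components, each a difference of two torques, give six times the bound of
  \<open>torque_diff_le\<close>.\<close>

lemma norm_rotation_rate_diff_le:
  assumes "bounded_on_ball \<sigma> R M"
    and "misorientation_size \<alpha> \<le> R" "misorientation_size \<beta> \<le> R"
    and "\<And>j. norm (x j - a) \<le> B"
  shows "norm (rotation_rate \<sigma> x \<alpha> a - rotation_rate \<sigma> x \<beta> b)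
    \<le> 12 * M * B * norm (\<alpha> - \<beta>) + 6 * M * norm (a - b)"
proof -
  define L where "L = 2 * M * B * norm (\<alpha> - \<beta>) + M * norm (a - b)"
  let ?d = "\<lambda>j. torque \<sigma> x \<alpha> a j - torque \<sigma> x \<beta> b j"
  have d: "\<bar>?d j\<bar> \<le> L" for j
    unfolding L_def by (rule torque_diff_le[OF assms])
  have "norm (rotation_rate \<sigma> x \<alpha> a - rotation_rate \<sigma> x \<beta> b)
      \<le> (\<Sum>j\<in>UNIV. \<bar>(rotation_rate \<sigma> x \<alpha> a - rotation_rate \<sigma> x \<beta> b) $ j\<bar>)"
    by (rule norm_le_l1_cart)
  also have "\<dots> = (\<Sum>j\<in>UNIV. \<bar>?d j - ?d (j + 1)\<bar>)"
    by (simp add: rotation_rate_def algebra_simps)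
  also have "\<dots> \<le> (\<Sum>j\<in>(UNIV :: 3 set). 2 * L)"
  proof (rule sum_mono)
    fix j :: 3
    show "\<bar>?d j - ?d (j + 1)\<bar> \<le> 2 * L" using d[of j] d[of "j + 1"] by linarith
  qed
  finally show ?thesis by (simp add: L_def algebra_simps)
qed

lemma norm_junction_velocity_diff_le:
  assumes M: "bounded_on_ball \<sigma> R M"
    and R: "misorientation_size \<alpha> \<le> R" "misorientation_size \<beta> \<le> R"
    and c: "0 < c" "\<And>j. c \<le> norm (x j - a)" "\<And>j. c \<le> norm (x j - b)"
  shows "norm (junction_velocity \<sigma> x \<alpha> a - junction_velocity \<sigma> x \<beta> b)
    \<le> 6 * M * norm (\<alpha> - \<beta>) + 6 * M / c * norm (a - b)"
proof -
  let ?p = "misorientation \<alpha>" and ?q = "misorientation \<beta>"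
  let ?u = "\<lambda>j. sgn (x j - a)" and ?w = "\<lambda>j. sgn (x j - b)"
  have M0: "0 \<le> M" using M by (auto simp: bounded_on_ball_def lipschitz_on_def)
  have term_le: "norm (\<sigma> (?p j) *\<^sub>R ?u j - \<sigma> (?q j) *\<^sub>R ?w j) \<le> 2 * M * norm (\<alpha> - \<beta>) + 2 * M / c * norm (a - b)" for j
  proof -
    have pq: "?p j \<in> {-R..R}" "?q j \<in> {-R..R}"
      using misorientation_le_size[of \<alpha> j] misorientation_le_size[of \<beta> j] R by auto
    have "\<bar>\<sigma> (?p j) - \<sigma> (?q j)\<bar> \<le> M * \<bar>?p j - ?q j\<bar>"
      using M pq by (auto simp: bounded_on_ball_def lipschitz_on_def dist_real_def)
    also have "\<dots> \<le> M * (2 * norm (\<alpha> - \<beta>))"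
      using misorientation_le_norm[of "\<alpha> - \<beta>" j] M0 by (intro mult_left_mono) (simp_all add: misorientation_diff)
    finally have "\<bar>\<sigma> (?p j) - \<sigma> (?q j)\<bar> * norm (?u j) \<le> (M * (2 * norm (\<alpha> - \<beta>))) * 1"
      using M0 by (intro mult_mono) (auto simp: norm_sgn)
    moreover have "norm (?u j - ?w j) \<le> 2 * norm (a - b) / c"
      using norm_sgn_diff_le[OF c(1), of "x j - a" "x j - b"] c(2,3) by (simp add: norm_minus_commute)
    then have "\<bar>\<sigma> (?q j)\<bar> * norm (?u j - ?w j) \<le> M * (2 * norm (a - b) / c)"
      using M pq M0 by (intro mult_mono) (auto simp: bounded_on_ball_def)
    \<comment> \<open>The first part is controlled by the Lipschitz constant of
      \<open>\<sigma>\<close> and a unit vector, the second by the bound on \<open>\<sigma>\<close>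
      and the Lipschitz constant \<open>2 / c\<close> of the direction.\<close>
    moreover have "\<sigma> (?p j) *\<^sub>R ?u j - \<sigma> (?q j) *\<^sub>R ?w j =
        (\<sigma> (?p j) - \<sigma> (?q j)) *\<^sub>R ?u j + \<sigma> (?q j) *\<^sub>R (?u j - ?w j)"
      by (simp add: algebra_simps)
    then have "norm (\<sigma> (?p j) *\<^sub>R ?u j - \<sigma> (?q j) *\<^sub>R ?w j) \<le>
        \<bar>\<sigma> (?p j) - \<sigma> (?q j)\<bar> * norm (?u j) + \<bar>\<sigma> (?q j)\<bar> * norm (?u j - ?w j)"
      by (metis norm_triangle_ineq norm_scaleR)
    ultimately show ?thesis by (simp add: algebra_simps)
  qed
  have "norm (junction_velocity \<sigma> x \<alpha> a - junction_velocity \<sigma> x \<beta> b)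
      \<le> (\<Sum>j\<in>(UNIV :: 3 set). 2 * M * norm (\<alpha> - \<beta>) + 2 * M / c * norm (a - b))"
    unfolding junction_velocity_def sum_subtractf[symmetric]
    by (rule sum_norm_le) (rule term_le)
  then show ?thesis by (simp add: algebra_simps)
qed

section \<open>The Gronwall argument\<close>

text \<open>The absolute values and the leading 1 make the rate positive for all real arguments, as
  the theorem demands. The coefficient 24 is twice the 12 of
  \<open>norm_rotation_rate_diff_le\<close>, the 2 coming from differentiating a square.\<close>

definition gronwall_rate :: "real \<Rightarrow> real \<Rightarrow> real \<Rightarrow> real \<Rightarrow> real" where
  "gronwall_rate C c E M = 1 + 24 * \<bar>M\<bar> * (1 + \<bar>E / C\<bar> + 1 / \<bar>c\<bar>)"

lemma gronwall_rate_pos: "0 < gronwall_rate C c E M"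
  by (simp add: gronwall_rate_def add_pos_nonneg)

text \<open>\<open>R\<close> and \<open>M\<close> are free here: the theorem takes the larger
  initial size and \<open>sigma_bound\<close>, while continuous dependence takes a slightly larger
  ball fixed in advance. Only the energy of the first solution enters the rate.\<close>

lemma stability_estimate:
  assumes \<sigma>: "surface_tension \<sigma> C" and c: "0 < c"
    and sol1: "classical_solution \<sigma> x T \<alpha>\<^sub>0 a\<^sub>0 \<alpha> a" and sol2: "classical_solution \<sigma> x T \<beta>\<^sub>0 b\<^sub>0 \<beta> b"
    and sep: "separated_by c x T a" "separated_by c x T b"
    and R: "misorientation_size \<alpha>\<^sub>0 \<le> R" "misorientation_size \<beta>\<^sub>0 \<le> R"
    and M: "bounded_on_ball \<sigma> R M"
    and t: "t \<in> {0..T}"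
  shows "(norm (\<alpha> t - \<beta> t))\<^sup>2 + (norm (a t - b t))\<^sup>2
    \<le> exp (gronwall_rate C c (energy \<sigma> x \<alpha>\<^sub>0 a\<^sub>0) M * t) * ((norm (\<alpha>\<^sub>0 - \<beta>\<^sub>0))\<^sup>2 + (norm (a\<^sub>0 - b\<^sub>0))\<^sup>2)"
proof -
  note s1 = classical_solutionD[OF sol1] and s2 = classical_solutionD[OF sol2]
  define B where "B = energy \<sigma> x \<alpha>\<^sub>0 a\<^sub>0 / C"
  define K where "K = gronwall_rate C c (energy \<sigma> x \<alpha>\<^sub>0 a\<^sub>0) M"
  define w where "w t = \<alpha> t - \<beta> t" for t
  define v where "v t = a t - b t" for t
  define w' where "w' t = rotation_rate \<sigma> x (\<alpha> t) (a t) - rotation_rate \<sigma> x (\<beta> t) (b t)" for t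
  define v' where "v' t = junction_velocity \<sigma> x (\<alpha> t) (a t) - junction_velocity \<sigma> x (\<beta> t) (b t)" for t
  let ?g = "\<lambda>t. (norm (w t))\<^sup>2 + (norm (v t))\<^sup>2"
  let ?g' = "\<lambda>t. 2 * (w t \<bullet> w' t) + 2 * (v t \<bullet> v' t)"
  have M0: "0 \<le> M" using M by (auto simp: bounded_on_ball_def lipschitz_on_def)
  have B0: "0 \<le> B"
    using order_trans[OF norm_ge_zero norm_branch_le[OF \<sigma> sol1 t]] by (simp add: B_def)
  have growth: "?g' s \<le> K * ?g s" if s: "s \<in> {0..T}" for s
  proof -
    let ?n = "norm (w s)" and ?m = "norm (v s)"
    have size: "misorientation_size (\<alpha> s) \<le> R" "misorientation_size (\<beta> s) \<le> R"
      using misorientation_size_antimono[OF \<sigma> sol1 s] misorientation_size_antimono[OF \<sigma> sol2 s] R by auto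
    have "norm (w' s) \<le> 12 * M * B * ?n + 6 * M * ?m"
      unfolding w'_def w_def v_def B_def
      by (intro norm_rotation_rate_diff_le[OF M size] norm_branch_le[OF \<sigma> sol1 s])
    then have "w s \<bullet> w' s \<le> ?n * (12 * M * B * ?n + 6 * M * ?m)"
      by (meson norm_cauchy_schwarz mult_left_mono norm_ge_zero order_trans)
    moreover have "norm (v' s) \<le> 6 * M * ?n + 6 * M / c * ?m"
      unfolding v'_def w_def v_def
      using sep s by (intro norm_junction_velocity_diff_le[OF M size c]) (auto simp: separated_by_def)
    then have "v s \<bullet> v' s \<le> ?m * (6 * M * ?n + 6 * M / c * ?m)"
      by (meson norm_cauchy_schwarz mult_left_mono norm_ge_zero order_trans)
    ultimately have "?g' s \<le> 2 * (?n * (12 * M * B * ?n + 6 * M * ?m)) + 2 * (?m * (6 * M * ?n + 6 * M / c * ?m))"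
      by linarith
    \<comment> \<open>Each of the two estimates contributes a cross term
      \<open>12 * M * ?n * ?m\<close>. Together they are written as a multiple of
      \<open>2 * ?n * ?m\<close>, which is at most the sum of the squares.\<close>
    also have "\<dots> = 24 * M * B * ?n\<^sup>2 + 12 * M * (2 * ?n * ?m) + 12 * (M / c) * ?m\<^sup>2"
      by (simp add: algebra_simps power2_eq_square)
    also have "\<dots> \<le> 24 * M * B * ?n\<^sup>2 + 12 * M * (?n\<^sup>2 + ?m\<^sup>2) + 12 * (M / c) * ?m\<^sup>2"
      using M0 sum_squares_bound[of ?n ?m] by (intro add_mono mult_left_mono order_refl) auto
    \<comment> \<open>Every term is enlarged to a multiple of \<open>?g s\<close>, with exactly the
      coefficients of \<open>gronwall_rate\<close>; the last summand accounts for its leading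
      1.\<close>
    also have "\<dots> \<le> 24 * M * B * ?g s + 24 * M * ?g s + 24 * (M / c) * ?g s + ?g s"
    proof -
      have "24 * M * B * ?n\<^sup>2 \<le> 24 * M * B * ?g s" using M0 B0 by (intro mult_left_mono) auto
      moreover have "12 * M * ?g s \<le> 24 * M * ?g s" using M0 by (intro mult_right_mono) auto
      moreover have "12 * (M / c) * ?m\<^sup>2 \<le> 24 * (M / c) * ?g s" using M0 c by (intro mult_mono) auto
      moreover have "0 \<le> ?g s" by simp
      ultimately show ?thesis by linarith
    qed
    also have "\<dots> = K * ?g s"
      using M0 B0 c by (simp add: K_def gronwall_rate_def B_def[symmetric] algebra_simps)
    finally show ?thesis .
  qed
  have "exp (- (K * t)) * ?g t \<le> exp (- (K * 0)) * ?g 0"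
  proof (rule antimono_within_interval[OF _ _ t, where g' = "\<lambda>s. exp (- (K * s)) * (?g' s - K * ?g s)"])
    fix s assume s: "s \<in> {0..T}"
    have "(w has_vector_derivative w' s) (at s within {0..T})"
      unfolding w_def w'_def by (intro has_vector_derivative_diff s1(4) s2(4) s)
    moreover have "(v has_vector_derivative v' s) (at s within {0..T})"
      unfolding v_def v'_def by (intro has_vector_derivative_diff s1(5) s2(5) s)
    ultimately have "(?g has_real_derivative ?g' s) (at s within {0..T})"
      by (intro DERIV_add has_real_derivative_norm_power2)
    moreover have "((\<lambda>t. exp (- (K * t))) has_real_derivative - K * exp (- (K * s))) (at s within {0..T})"
      by (auto intro!: derivative_eq_intros)
    ultimately show "((\<lambda>t. exp (- (K * t)) * ?g t) has_real_derivative exp (- (K * s)) * (?g' s - K * ?g s)) (at s within {0..T})"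
      by (rule DERIV_cong[OF DERIV_mult[rotated]]) (simp add: algebra_simps)
    show "exp (- (K * s)) * (?g' s - K * ?g s) \<le> 0"
      using growth[OF s] by (simp add: mult_nonneg_nonpos)
  qed
  then have "?g t \<le> exp (K * t) * ?g 0"
    by (simp add: exp_minus field_simps)
  then show ?thesis by (simp add: w_def v_def K_def s1 s2)
qed

section \<open>The supremum \<open>M\<close> as a bound and a Lipschitz constant\<close>

lemma deriv_lipschitz_on_interval:
  assumes "surface_tension \<sigma> C"
  obtains L where "L-lipschitz_on {-R..R} (deriv \<sigma>)"
proof -
  \<comment> \<open>\<open>local_lipschitz\<close> speaks of time-dependent maps, so a dummy time
    set with one point is used. Compactness of the interval then turns local constants into a global
    one.\<close>
  have "local_lipschitz {0::real} {-R..R} (\<lambda>_. deriv \<sigma>)"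
    unfolding local_lipschitz_def
  proof (intro ballI)
    fix \<theta> and t :: real
    obtain r L where "0 < r" and L: "L-lipschitz_on (ball \<theta> r) (deriv \<sigma>)"
      using assms unfolding surface_tension_def by blast
    then have "L-lipschitz_on (cball \<theta> (r / 2) \<inter> {-R..R}) (deriv \<sigma>)"
      by (intro lipschitz_on_subset[OF L]) auto
    then show "\<exists>u>0. \<exists>L. \<forall>t\<in>cball t u \<inter> {0}. L-lipschitz_on (cball \<theta> u \<inter> {-R..R}) (deriv \<sigma>)"
      using \<open>0 < r\<close> by (intro exI[of _ "r / 2"]) auto
  qed
  then obtain L where "\<And>t. t \<in> {0::real} \<Longrightarrow> L-lipschitz_on {-R..R} (deriv \<sigma>)"
    by (rule local_lipschitz_compact_implies_lipschitz) (auto intro: continuous_on_const)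
  then show ?thesis using that by simp
qed

text \<open>The set is first shown to be bounded above, so that its supremum dominates every
  element. Special choices of the three arguments then isolate each of the required bounds.\<close>

lemma bounded_on_ball_Sup:
  assumes \<sigma>: "surface_tension \<sigma> C" and R0: "0 \<le> R"
  shows "bounded_on_ball \<sigma> R (Sup {\<bar>\<sigma> \<theta>\<bar> + \<bar>deriv \<sigma> \<theta>\<bar> + \<bar>deriv \<sigma> \<theta>\<^sub>1 - deriv \<sigma> \<theta>\<^sub>2\<bar> / \<bar>\<theta>\<^sub>1 - \<theta>\<^sub>2\<bar> | \<theta> \<theta>\<^sub>1 \<theta>\<^sub>2.
    \<bar>\<theta>\<bar> \<le> R \<and> \<bar>\<theta>\<^sub>1\<bar> \<le> R \<and> \<bar>\<theta>\<^sub>2\<bar> \<le> R})"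
proof -
  define q where "q \<theta> \<theta>\<^sub>1 \<theta>\<^sub>2 = \<bar>\<sigma> \<theta>\<bar> + \<bar>deriv \<sigma> \<theta>\<bar> + \<bar>deriv \<sigma> \<theta>\<^sub>1 - deriv \<sigma> \<theta>\<^sub>2\<bar> / \<bar>\<theta>\<^sub>1 - \<theta>\<^sub>2\<bar>" for \<theta> \<theta>\<^sub>1 \<theta>\<^sub>2
  define S where "S = {q \<theta> \<theta>\<^sub>1 \<theta>\<^sub>2 | \<theta> \<theta>\<^sub>1 \<theta>\<^sub>2. \<bar>\<theta>\<bar> \<le> R \<and> \<bar>\<theta>\<^sub>1\<bar> \<le> R \<and> \<bar>\<theta>\<^sub>2\<bar> \<le> R}"
  define M where "M = Sup S"
  have \<sigma>': "(\<sigma> has_real_derivative deriv \<sigma> \<theta>) (at \<theta>)" for \<theta>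
    using \<sigma> by (simp add: surface_tension_def DERIV_deriv_iff_field_differentiable)
  obtain L where L: "L-lipschitz_on {-R..R} (deriv \<sigma>)"
    by (rule deriv_lipschitz_on_interval[OF \<sigma>])
  have "continuous_on {-R..R} (deriv \<sigma>)" "continuous_on {-R..R} \<sigma>"
    using L lipschitz_on_continuous_on DERIV_continuous_on[OF has_field_derivative_at_within[OF \<sigma>']] by blast+
  then have "bounded (deriv \<sigma> ` {-R..R})" "bounded (\<sigma> ` {-R..R})"
    by (auto intro!: compact_imp_bounded compact_continuous_image)
  then obtain D A where D: "\<And>\<theta>. \<theta> \<in> {-R..R} \<Longrightarrow> \<bar>deriv \<sigma> \<theta>\<bar> \<le> D"
    and A: "\<And>\<theta>. \<theta> \<in> {-R..R} \<Longrightarrow> \<bar>\<sigma> \<theta>\<bar> \<le> A"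
    unfolding bounded_iff ball_simps real_norm_def by blast
  have L0: "0 \<le> L" using L by (simp add: lipschitz_on_def)
  have "bdd_above S"
  proof (rule bdd_aboveI[of _ "A + D + L"])
    fix y assume "y \<in> S"
    then obtain \<theta> \<theta>\<^sub>1 \<theta>\<^sub>2 where y: "y = q \<theta> \<theta>\<^sub>1 \<theta>\<^sub>2" and "\<bar>\<theta>\<bar> \<le> R" "\<bar>\<theta>\<^sub>1\<bar> \<le> R" "\<bar>\<theta>\<^sub>2\<bar> \<le> R"
      unfolding S_def by blast
    then have \<theta>: "\<theta> \<in> {-R..R}" "\<theta>\<^sub>1 \<in> {-R..R}" "\<theta>\<^sub>2 \<in> {-R..R}" by auto
    have "\<bar>deriv \<sigma> \<theta>\<^sub>1 - deriv \<sigma> \<theta>\<^sub>2\<bar> \<le> L * \<bar>\<theta>\<^sub>1 - \<theta>\<^sub>2\<bar>"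
      using lipschitz_onD[OF L \<theta>(2,3)] by (simp add: dist_real_def)
    then have "\<bar>deriv \<sigma> \<theta>\<^sub>1 - deriv \<sigma> \<theta>\<^sub>2\<bar> / \<bar>\<theta>\<^sub>1 - \<theta>\<^sub>2\<bar> \<le> L"
      \<comment> \<open>On the diagonal the quotient is 0 by division by zero, hence the need for
        \<open>L0\<close>.\<close>
      using L0 by (cases "\<theta>\<^sub>1 = \<theta>\<^sub>2") (auto simp: divide_le_eq)
    then show "y \<le> A + D + L"
      using A[OF \<theta>(1)] D[OF \<theta>(1)] by (simp add: y q_def)
  qed
  then have q: "q \<theta> \<theta>\<^sub>1 \<theta>\<^sub>2 \<le> M" if "\<theta> \<in> {-R..R}" "\<theta>\<^sub>1 \<in> {-R..R}" "\<theta>\<^sub>2 \<in> {-R..R}" for \<theta> \<theta>\<^sub>1 \<theta>\<^sub>2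
    unfolding M_def
  proof (rule cSup_upper[rotated])
    show "q \<theta> \<theta>\<^sub>1 \<theta>\<^sub>2 \<in> S" using that unfolding S_def by (intro CollectI exI conjI refl) auto
  qed
  have bound: "\<bar>\<sigma> \<theta>\<bar> \<le> M" "\<bar>deriv \<sigma> \<theta>\<bar> \<le> M" if "\<theta> \<in> {-R..R}" for \<theta>
    using q[OF that that that] by (auto simp: q_def)
  \<comment> \<open>As \<open>R\<close> is nonnegative the interval is nonempty, and
    \<open>M\<close> dominates an absolute value.\<close>
  then have M0: "0 \<le> M" using R0 by (force dest: order_trans[OF abs_ge_zero])
  have "M-lipschitz_on {-R..R} (deriv \<sigma>)"
  proof (rule lipschitz_onI[OF _ M0])
    fix y z assume yz: "y \<in> {-R..R}" "z \<in> {-R..R}"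
    have "\<bar>deriv \<sigma> y - deriv \<sigma> z\<bar> / \<bar>y - z\<bar> \<le> M"
      using q[OF yz(1) yz] by (simp add: q_def)
    then show "dist (deriv \<sigma> y) (deriv \<sigma> z) \<le> M * dist y z"
      by (cases "y = z") (auto simp: dist_real_def divide_le_eq)
  qed
  \<comment> \<open>The supremum has no difference quotient of \<open>\<sigma>\<close> itself; the
    mean value inequality supplies it from the bound on \<open>deriv \<sigma>\<close>.\<close>
  moreover have "M-lipschitz_on {-R..R} \<sigma>"
  proof (rule lipschitz_onI[OF _ M0])
    fix y z assume "y \<in> {-R..R}" "z \<in> {-R..R}"
    then show "dist (\<sigma> y) (\<sigma> z) \<le> M * dist y z"
      using field_differentiable_bound[of "{-R..R}" \<sigma> "deriv \<sigma>" M y z]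
        has_field_derivative_at_within[OF \<sigma>'] bound(2)
      by (simp add: dist_norm)
  qed
  ultimately show ?thesis
    using bound by (auto simp: bounded_on_ball_def M_def S_def q_def)
qed

lemma misorientation_size_nonneg: "0 \<le> misorientation_size \<alpha>"
  by (simp add: misorientation_size_def sum_nonneg)

lemma bounded_on_ball_sigma_bound:
  assumes "surface_tension \<sigma> C"
  shows "bounded_on_ball \<sigma> (max (misorientation_size \<alpha>) (misorientation_size \<beta>)) (sigma_bound \<sigma> \<alpha> \<beta>)"
  unfolding sigma_bound_def Let_def
  by (rule bounded_on_ball_Sup[OF assms]) (simp add: misorientation_size_nonneg le_max_iff_disj)

section \<open>Continuous dependence on the initial data\<close>

lemma sup_norm_le:
  assumes "0 \<le> T" "\<And>t. t \<in> {0..T} \<Longrightarrow> norm (f t) \<le> B"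
  shows "sup_norm T f \<le> B"
  unfolding sup_norm_def using assms by (intro cSUP_least) auto

lemma continuous_dependence:
  assumes \<sigma>: "surface_tension \<sigma> C" and T: "0 \<le> T" and c: "0 < c"
    and sol: "classical_solution \<sigma> x T \<beta>\<^sub>0 b\<^sub>0 \<beta> b" and sep: "separated_by c x T b" and \<epsilon>: "0 < \<epsilon>"
  shows "\<forall>\<^sub>F (\<alpha>\<^sub>0, a\<^sub>0) in nhds (\<beta>\<^sub>0, b\<^sub>0). \<forall>\<alpha> a.
    classical_solution \<sigma> x T \<alpha>\<^sub>0 a\<^sub>0 \<alpha> a \<and> separated_by c x T a \<longrightarrow>
    sup_norm T (\<lambda>t. \<alpha> t - \<beta> t) + sup_norm T (\<lambda>t. a t - b t) < \<epsilon>"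
proof -
  \<comment> \<open>The margin 1 leaves room for perturbed data: the misorientation size is
    continuous, so it stays below \<open>R\<close> near \<open>\<beta>\<^sub>0\<close>. Thus
    \<open>M\<close> and \<open>K\<close> are fixed before the perturbation.\<close>
  define R where "R = misorientation_size \<beta>\<^sub>0 + 1"
  then obtain M where M: "bounded_on_ball \<sigma> R M"
    using bounded_on_ball_Sup[OF \<sigma>, of R] misorientation_size_nonneg[of \<beta>\<^sub>0] by auto
  define K where "K = gronwall_rate C c (energy \<sigma> x \<beta>\<^sub>0 b\<^sub>0) M"
  have K: "0 < K" by (simp add: K_def gronwall_rate_pos)
  \<comment> \<open>The square root of the estimate at the final time bounds both differences
    separately, hence both sup norms. Their sum is at most \<open>2 * ?d p\<close>, which tends to 0
    at the base point.\<close>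
  let ?d = "\<lambda>p. sqrt (exp (K * T) * ((norm (\<beta>\<^sub>0 - fst p))\<^sup>2 + (norm (b\<^sub>0 - snd p))\<^sup>2))"
  let ?F = "nhds (\<beta>\<^sub>0, b\<^sub>0)"
  have fst_lim: "(fst \<longlongrightarrow> \<beta>\<^sub>0) ?F" and snd_lim: "(snd \<longlongrightarrow> b\<^sub>0) ?F"
    using tendsto_fst[OF filterlim_ident[of ?F]] tendsto_snd[OF filterlim_ident[of ?F]] by simp_all
  have "((\<lambda>p. misorientation_size (fst p)) \<longlongrightarrow> misorientation_size \<beta>\<^sub>0) ?F"
    unfolding misorientation_size_def misorientation_def by (intro tendsto_intros fst_lim)
  then have "\<forall>\<^sub>F p in ?F. misorientation_size (fst p) < R"
    by (rule order_tendstoD) (simp add: R_def)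
  moreover have "((\<lambda>p. 2 * ?d p) \<longlongrightarrow> 2 * ?d (\<beta>\<^sub>0, b\<^sub>0)) ?F"
    unfolding fst_conv snd_conv by (intro tendsto_intros fst_lim snd_lim)
  then have "\<forall>\<^sub>F p in ?F. 2 * ?d p < \<epsilon>"
    by (rule order_tendstoD) (simp add: \<epsilon>)
  ultimately show ?thesis
  proof eventually_elim
    case (elim p)
    obtain \<alpha>\<^sub>0 a\<^sub>0 where p: "p = (\<alpha>\<^sub>0, a\<^sub>0)" by (cases p)
    have "sup_norm T (\<lambda>t. \<alpha> t - \<beta> t) + sup_norm T (\<lambda>t. a t - b t) < \<epsilon>"
      if sol': "classical_solution \<sigma> x T \<alpha>\<^sub>0 a\<^sub>0 \<alpha> a" and sep': "separated_by c x T a" for \<alpha> a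
    proof -
      have "norm (\<alpha> t - \<beta> t) \<le> ?d p \<and> norm (a t - b t) \<le> ?d p" if t: "t \<in> {0..T}" for t
      proof -
        have "(norm (\<beta> t - \<alpha> t))\<^sup>2 + (norm (b t - a t))\<^sup>2
            \<le> exp (K * t) * ((norm (\<beta>\<^sub>0 - \<alpha>\<^sub>0))\<^sup>2 + (norm (b\<^sub>0 - a\<^sub>0))\<^sup>2)"
          unfolding K_def
          \<comment> \<open>The unperturbed solution is put first, so that the rate involves its
            energy and not that of the varying solution.\<close>
          by (rule stability_estimate[OF \<sigma> c sol sol' sep sep' _ _ M t])
            (use elim p in \<open>auto simp: R_def\<close>)
        also have "\<dots> \<le> exp (K * T) * ((norm (\<beta>\<^sub>0 - \<alpha>\<^sub>0))\<^sup>2 + (norm (b\<^sub>0 - a\<^sub>0))\<^sup>2)"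
          using t K by (intro mult_right_mono) auto
        finally have "(norm (\<alpha> t - \<beta> t))\<^sup>2 + (norm (a t - b t))\<^sup>2
            \<le> exp (K * T) * ((norm (\<beta>\<^sub>0 - \<alpha>\<^sub>0))\<^sup>2 + (norm (b\<^sub>0 - a\<^sub>0))\<^sup>2)"
          by (simp add: norm_minus_commute)
        then show ?thesis
          unfolding p fst_conv snd_conv
          by (intro conjI real_le_rsqrt; smt (verit) zero_le_power2)
      qed
      then have "sup_norm T (\<lambda>t. \<alpha> t - \<beta> t) \<le> ?d p" "sup_norm T (\<lambda>t. a t - b t) \<le> ?d p"
        by (auto intro!: sup_norm_le T)
      with elim(2) show ?thesis by linarith
    qed
    then show ?case by (simp add: p)
  qed
qed

theorem theorem6p4:
  "\<exists>K :: real \<Rightarrow> real \<Rightarrow> real \<Rightarrow> real \<Rightarrow> real.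
     (\<forall>C\<^sub>1 c E M. 0 < K C\<^sub>1 c E M) \<and>
     (\<forall>(\<sigma> :: real \<Rightarrow> real) C\<^sub>1 (x :: 3 \<Rightarrow> real ^ 2) T c.
        surface_tension \<sigma> C\<^sub>1 \<and> 0 \<le> T \<and> 0 < c \<longrightarrow>
        (\<forall>\<alpha>\<^sub>0\<^sub>1 a\<^sub>0\<^sub>1 \<alpha>\<^sub>0\<^sub>2 a\<^sub>0\<^sub>2 \<alpha>\<^sub>1 a\<^sub>1 \<alpha>\<^sub>2 a\<^sub>2.
           classical_solution \<sigma> x T \<alpha>\<^sub>0\<^sub>1 a\<^sub>0\<^sub>1 \<alpha>\<^sub>1 a\<^sub>1 \<and>
           classical_solution \<sigma> x T \<alpha>\<^sub>0\<^sub>2 a\<^sub>0\<^sub>2 \<alpha>\<^sub>2 a\<^sub>2 \<and>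
           separated_by c x T a\<^sub>1 \<and> separated_by c x T a\<^sub>2 \<longrightarrow>
           (\<forall>t\<in>{0..T}.
              (norm (\<alpha>\<^sub>1 t - \<alpha>\<^sub>2 t))\<^sup>2 + (norm (a\<^sub>1 t - a\<^sub>2 t))\<^sup>2
              \<le> exp (K C\<^sub>1 c (energy \<sigma> x \<alpha>\<^sub>0\<^sub>1 a\<^sub>0\<^sub>1) (sigma_bound \<sigma> \<alpha>\<^sub>0\<^sub>1 \<alpha>\<^sub>0\<^sub>2) * t)
                * ((norm (\<alpha>\<^sub>0\<^sub>1 - \<alpha>\<^sub>0\<^sub>2))\<^sup>2 + (norm (a\<^sub>0\<^sub>1 - a\<^sub>0\<^sub>2))\<^sup>2))) \<and>
        (\<forall>\<alpha>\<^sub>0\<^sub>2 a\<^sub>0\<^sub>2 \<alpha>\<^sub>2 a\<^sub>2.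
           classical_solution \<sigma> x T \<alpha>\<^sub>0\<^sub>2 a\<^sub>0\<^sub>2 \<alpha>\<^sub>2 a\<^sub>2 \<and> separated_by c x T a\<^sub>2 \<longrightarrow>
           (\<forall>\<epsilon>>0. \<forall>\<^sub>F (\<alpha>\<^sub>0\<^sub>1, a\<^sub>0\<^sub>1) in nhds (\<alpha>\<^sub>0\<^sub>2, a\<^sub>0\<^sub>2). \<forall>\<alpha>\<^sub>1 a\<^sub>1.
              classical_solution \<sigma> x T \<alpha>\<^sub>0\<^sub>1 a\<^sub>0\<^sub>1 \<alpha>\<^sub>1 a\<^sub>1 \<and> separated_by c x T a\<^sub>1 \<longrightarrow>
              sup_norm T (\<lambda>t. \<alpha>\<^sub>1 t - \<alpha>\<^sub>2 t) + sup_norm T (\<lambda>t. a\<^sub>1 t - a\<^sub>2 t) < \<epsilon>)))"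
proof (intro exI conjI allI impI ballI)
  show "0 < gronwall_rate C\<^sub>1 c E M" for C\<^sub>1 c E M
    by (rule gronwall_rate_pos)
next
  fix \<sigma> :: "real \<Rightarrow> real" and C\<^sub>1 and x :: "3 \<Rightarrow> real ^ 2" and T c \<alpha>\<^sub>0\<^sub>1 a\<^sub>0\<^sub>1 \<alpha>\<^sub>0\<^sub>2 a\<^sub>0\<^sub>2 \<alpha>\<^sub>1 a\<^sub>1 \<alpha>\<^sub>2 a\<^sub>2 t
  assume *: "surface_tension \<sigma> C\<^sub>1 \<and> 0 \<le> T \<and> 0 < c"
    "classical_solution \<sigma> x T \<alpha>\<^sub>0\<^sub>1 a\<^sub>0\<^sub>1 \<alpha>\<^sub>1 a\<^sub>1 \<and> classical_solution \<sigma> x T \<alpha>\<^sub>0\<^sub>2 a\<^sub>0\<^sub>2 \<alpha>\<^sub>2 a\<^sub>2 \<and>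
      separated_by c x T a\<^sub>1 \<and> separated_by c x T a\<^sub>2"
    "t \<in> {0..T}"
  then show "(norm (\<alpha>\<^sub>1 t - \<alpha>\<^sub>2 t))\<^sup>2 + (norm (a\<^sub>1 t - a\<^sub>2 t))\<^sup>2
      \<le> exp (gronwall_rate C\<^sub>1 c (energy \<sigma> x \<alpha>\<^sub>0\<^sub>1 a\<^sub>0\<^sub>1) (sigma_bound \<sigma> \<alpha>\<^sub>0\<^sub>1 \<alpha>\<^sub>0\<^sub>2) * t)
        * ((norm (\<alpha>\<^sub>0\<^sub>1 - \<alpha>\<^sub>0\<^sub>2))\<^sup>2 + (norm (a\<^sub>0\<^sub>1 - a\<^sub>0\<^sub>2))\<^sup>2)"
    \<comment> \<open>Unification with \<open>bounded_on_ball_sigma_bound\<close> sets the radius to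
      the maximum of the two initial sizes, so both size conditions are immediate.\<close>
    by (intro stability_estimate[OF _ _ _ _ _ _ _ _ bounded_on_ball_sigma_bound]) auto
qed (auto intro: continuous_dependence)

end
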